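(* Let $M^2\subset\mathbb{R}^3$ be a CPD surface locally parametrized by $$X(u,v)=(f(u),u,0)+h(v)\,n(u)+v\,e_3,\qquad n=\frac{(-1,f',0)}{\sqrt{1+f'^2}},$$ with directrix curve $\gamma(u)=(f(u),u)$ and profile curve $\beta(v)=(h(v),v)$, and suppose that the Gaussian curvature of $M^2$ is nonzero. Let $a,b\in\mathbb{R}$. Then $$N_1A_M=aX_1+b$$ if and only if there exist a constant $C\in\mathbb{R}$ and local coordinates $(\theta,\phi)\in U$ such that the directrix and profile curves of $M^2$ are given by $$\gamma(\theta)=\begin{cases}\Big(C_1\sec^{a}\theta-\frac{C}{a+1}\cos\theta-\frac{b}{a},\; C_2+\frac{C}{a+1}\sin\theta+aC_1\int\sec^{a}\theta\,d\theta\Big), & a\in\mathbb{R}\setminus\{-1,0\},\\[0.6em] \Big(C_1-C\cos\theta-b\ln(\cos\theta),\; C_2+b\,\theta+C\sin\theta\Big), & a=0,\\[0.6em] \Big(b+C_1\cos\theta-C\cos\theta\ln(\cos\theta),\; C_2-C_1\sin\theta+C\big[\sin\theta\ln(\cos\theta)+\ln(\sec\theta+\tan\theta)\big]\Big), & a=-1,\end{cases}$$ and $$\beta(\phi)=\begin{cases}\Big(C_3\sec^{1+a}\phi-\frac{C}{a+1},\; C_4+(1+a)C_3\int\sec^{1+a}\phi\,d\phi\Big), & a\neq -1,\\[0.6em] \Big(-C\ln(\cos\phi)+C_3,\; C_4+C\phi\Big), & a=-1,\end{cases}$$ with constants $C_1\neq 0$, $C_3\neq 0$ and $C_2,C_4\in\mathbb{R}$,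 where $$U=\Big\{(\theta,\phi)\in J\times\big(-\tfrac{\pi}{2},\tfrac{\pi}{2}\big)\;:\;1-\kappa_\gamma\,\beta_1(\phi)\neq 0\Big\}$$ and $$J=\begin{cases}\big\{\theta\in(-\frac{\pi}{2},\frac{\pi}{2}) : aC_1\sec^{a+1}\theta+\frac{C}{a+1}\neq 0\big\}, & a\in\mathbb{R}\setminus\{-1,0\},\\[0.4em] \big\{\theta\in(-\frac{\pi}{2},\frac{\pi}{2}) : b\sec\theta+C\neq 0\big\}, & a=0,\\[0.4em] \big\{\theta\in(-\frac{\pi}{2},\frac{\pi}{2}) : C(1+\ln\cos\theta)-C_1\neq 0\big\}, & a=-1.\end{cases}$$
   Context: A surface $M^2\subset\mathbb{R}^3$ has a canonical principal direction (is a CPD surface) with respect to a unit vector $d$ if the tangential part $d^T$ of $d$ along $M$ is a principal direction; locally, with $d=e_3$ and directrix and profile curves of graph type, it is parametrized as in the claim. The curvature of $\gamma$ (with respect to $n$) is $\kappa_\gamma=-f''/(1+f'^2)^{3/2}$, and $\beta_1$ is the first coordinate of $\beta$. The unit normal of $X$ is $N=\frac{1}{\sqrt{1+h'^2}}(h'e_3-n)$. $A_M=\frac{1}{\kappa_1}+\frac1{\kappa_2}$ is the sum of the principal radial curvatures, $\kappa_1,\kappa_2$ being the principal curvatures with respect to $N$ (convention $N_{,i}=-\kappa_iX_{,i}$ along lines of curvature); $X_1=\langle X,e_1\rangle$ is the height function and $N_1=\langle N,e_1\rangle$ the angle function. Explicitly $X_1=f(u)-\frac{h(v)}{\sqrt{1+f'(u)^2}}$,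 $N_1=\frac{1}{\sqrt{1+f'(u)^2}\sqrt{1+h'(v)^2}}$ and $A_M=-\sqrt{1+h'^2}\Big(-\frac{(1+f'^2)^{3/2}}{f''}-h+\frac{1+h'^2}{h''}\Big)$. The product $N_1A_M$ does not depend on the choice of sign of $N$. Integral signs denote antiderivatives.
   Formalization: The condition C₁≠0, C₃≠0 fails in general (e.g. a=0, b=1, f=−ln cos u, h=cosh v forces C₁=0); it is replaced by: C₃≠0 if a≠−1, and C₁≠0 if a∉{0,−1} unless γ has constant curvature; no condition on C₁ for a=0, nor on C₁, C₃ for a=−1. *)

theory Defs
  imports "HOL-Analysis.Analysis"
begin

(* Local surface theory for a map X :: real * real => real^3 with unit normal field N.
   A tangent vector t = dX(w) is principal with curvature k if dN(w) = - k t; this is the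
   sign convention N_i = - k_i X_i along lines of curvature. *)

definition regular_param :: "(real \<times> real \<Rightarrow> real^3) \<Rightarrow> (real \<times> real) set \<Rightarrow> bool" where
  "regular_param X D \<longleftrightarrow>
     (\<forall>p\<in>D. X differentiable (at p) \<and> inj (frechet_derivative X (at p)))"

definition curvature_in_direction ::
  "(real \<times> real \<Rightarrow> real^3) \<Rightarrow> (real \<times> real \<Rightarrow> real^3) \<Rightarrow> real \<times> real \<Rightarrow> real \<Rightarrow> real^3 \<Rightarrow> bool" where
  "curvature_in_direction X N p k t \<longleftrightarrow> t \<noteq> 0 \<and>
     (\<exists>w. frechet_derivative X (at p) w = t \<and> frechet_derivative N (at p) w = - (k *\<^sub>R t))"

definition principal_direction ::
  "(real \<times> real \<Rightarrow> real^3) \<Rightarrow> (real \<times> real \<Rightarrow> real^3) \<Rightarrow> real \<times> real \<Rightarrow> real^3 \<Rightarrow> bool" where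
  "principal_direction X N p t \<longleftrightarrow> (\<exists>k. curvature_in_direction X N p k t)"

(* Both principal curvatures, counted with multiplicity at umbilics. *)
definition principal_curvatures ::
  "(real \<times> real \<Rightarrow> real^3) \<Rightarrow> (real \<times> real \<Rightarrow> real^3) \<Rightarrow> real \<times> real \<Rightarrow> real \<Rightarrow> real \<Rightarrow> bool" where
  "principal_curvatures X N p k1 k2 \<longleftrightarrow>
     (\<exists>t1 t2. t1 \<noteq> t2 \<and> independent {t1, t2} \<and>
        curvature_in_direction X N p k1 t1 \<and> curvature_in_direction X N p k2 t2)"

definition gauss_curvature ::
  "(real \<times> real \<Rightarrow> real^3) \<Rightarrow> (real \<times> real \<Rightarrow> real^3) \<Rightarrow> real \<times> real \<Rightarrow> real" where
  "gauss_curvature X N p =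
     (THE r. \<exists>k1 k2. principal_curvatures X N p k1 k2 \<and> r = k1 * k2)"

definition principal_radii_sum ::
  "(real \<times> real \<Rightarrow> real^3) \<Rightarrow> (real \<times> real \<Rightarrow> real^3) \<Rightarrow> real \<times> real \<Rightarrow> real" where
  "principal_radii_sum X N p =
     (THE r. \<exists>k1 k2. principal_curvatures X N p k1 k2 \<and> r = 1 / k1 + 1 / k2)"

definition canonical_principal_direction ::
  "(real \<times> real \<Rightarrow> real^3) \<Rightarrow> (real \<times> real \<Rightarrow> real^3) \<Rightarrow> (real \<times> real) set \<Rightarrow> real^3 \<Rightarrow> bool" where
  "canonical_principal_direction X N D d \<longleftrightarrow> norm d = 1 \<and>
     (\<forall>p\<in>D. principal_direction X N p (d - (d \<bullet> N p) *\<^sub>R N p))"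

definition dir_normal :: "(real \<Rightarrow> real) \<Rightarrow> real \<Rightarrow> real^3" where
  "dir_normal f u = (1 / sqrt (1 + (deriv f u)\<^sup>2)) *\<^sub>R vector [-1, deriv f u, 0]"

definition cpd_param :: "(real \<Rightarrow> real) \<Rightarrow> (real \<Rightarrow> real) \<Rightarrow> real \<times> real \<Rightarrow> real^3" where
  "cpd_param f h = (\<lambda>(u, v). vector [f u, u, 0] + h v *\<^sub>R dir_normal f u + v *\<^sub>R axis 3 1)"

definition cpd_normal :: "(real \<Rightarrow> real) \<Rightarrow> (real \<Rightarrow> real) \<Rightarrow> real \<times> real \<Rightarrow> real^3" where
  "cpd_normal f h = (\<lambda>(u, v).
     (1 / sqrt (1 + (deriv h v)\<^sup>2)) *\<^sub>R (deriv h v *\<^sub>R axis 3 1 - dir_normal f u))"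

definition C2_on :: "(real \<Rightarrow> real) \<Rightarrow> real set \<Rightarrow> bool" where
  "C2_on f A \<longleftrightarrow> f differentiable_on A \<and> deriv f differentiable_on A \<and>
     continuous_on A (deriv (deriv f))"

(* In the theorem the inverse of such a change is the second component of one of the curves
   below, which is analytic with nonzero derivative; so the change is in fact smooth. *)
definition coordinate_change_on :: "(real \<Rightarrow> real) \<Rightarrow> real set \<Rightarrow> bool" where
  "coordinate_change_on g A \<longleftrightarrow> g differentiable_on A \<and> continuous_on A (deriv g) \<and>
     (\<forall>x\<in>A. deriv g x \<noteq> 0)"

(* Signed curvature <c'', n> / |c'|^2 of a plane curve c with respect to the unit normal n
   whose first component is negative, whatever the orientation of the parameter.  The factor
   sgn y' selects this normal.  For c(u) = (f u, u) one has n = (-1, f') / sqrt (1 + f'^2) and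
   the value is - f'' / (1 + f'^2)^(3/2). *)
definition plane_curvature :: "(real \<Rightarrow> real \<times> real) \<Rightarrow> real \<Rightarrow> real" where
  "plane_curvature c t =
     (let x = (\<lambda>s. fst (c s)); y = (\<lambda>s. snd (c s)) in
      sgn (deriv y t) * (deriv x t * deriv (deriv y) t - deriv y t * deriv (deriv x) t)
        / (sqrt ((deriv x t)\<^sup>2 + (deriv y t)\<^sup>2)) ^ 3)"

definition sec :: "real \<Rightarrow> real" where
  "sec t = 1 / cos t"

(* The real power of sec is only used on (-pi/2, pi/2), where sec is positive. *)
definition sec_power_antiderivative :: "real \<Rightarrow> (real \<Rightarrow> real) \<Rightarrow> bool" where
  "sec_power_antiderivative a S \<longleftrightarrow>
     (\<forall>t\<in>{-pi/2<..<pi/2}. (S has_real_derivative sec t powr a) (at t))"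

(* S stands for an antiderivative of sec^a, T for one of sec^(1+a). *)

definition directrix ::
  "real \<Rightarrow> real \<Rightarrow> (real \<Rightarrow> real) \<Rightarrow> real \<Rightarrow> real \<Rightarrow> real \<Rightarrow> real \<Rightarrow> real \<times> real" where
  "directrix a b S C C1 C2 t =
     (if a = 0 then
        (C1 - C * cos t - b * ln (cos t),
         C2 + b * t + C * sin t)
      else if a = -1 then
        (b + C1 * cos t - C * cos t * ln (cos t),
         C2 - C1 * sin t + C * (sin t * ln (cos t) + ln (sec t + tan t)))
      else
        (C1 * sec t powr a - C / (a + 1) * cos t - b / a,
         C2 + C / (a + 1) * sin t + a * C1 * S t))"

definition profile ::
  "real \<Rightarrow> (real \<Rightarrow> real) \<Rightarrow> real \<Rightarrow> real \<Rightarrow> real \<Rightarrow> real \<Rightarrow> real \<times> real" where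
  "profile a T C C3 C4 s =
     (if a = -1 then (- C * ln (cos s) + C3, C4 + C * s)
      else (C3 * sec s powr (1 + a) - C / (a + 1), C4 + (1 + a) * C3 * T s))"

definition J_set :: "real \<Rightarrow> real \<Rightarrow> real \<Rightarrow> real \<Rightarrow> real set" where
  "J_set a b C C1 = {t \<in> {-pi/2<..<pi/2}.
     if a = 0 then b * sec t + C \<noteq> 0
     else if a = -1 then C * (1 + ln (cos t)) - C1 \<noteq> 0
     else a * C1 * sec t powr (a + 1) + C / (a + 1) \<noteq> 0}"

definition U_set ::
  "real \<Rightarrow> real \<Rightarrow> (real \<Rightarrow> real) \<Rightarrow> (real \<Rightarrow> real) \<Rightarrow>
   real \<Rightarrow> real \<Rightarrow> real \<Rightarrow> real \<Rightarrow> real \<Rightarrow> (real \<times> real) set" where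
  "U_set a b S T C C1 C2 C3 C4 = {(t, s) \<in> J_set a b C C1 \<times> {-pi/2<..<pi/2}.
     1 - plane_curvature (directrix a b S C C1 C2) t * fst (profile a T C C3 C4 s) \<noteq> 0}"

(* Nonvanishing of C1 and C3, required exactly where it is a genuine nondegeneracy condition.
   For a = 0 the constant C1 is a translation of the directrix along e1, which leaves
   N_1 A_M = b unchanged, and for a = -1 both C1 and C3 may vanish (only C cannot).  For other
   a, the constant C1 vanishes precisely when the directrix is an arc of a circle, i.e. when
   the surface is rotational about a vertical axis; such surfaces do satisfy
   N_1 A_M = a X_1 + b for suitable profiles.  Example with a = 1, b = 0, C1 = 0:
   f u = - sqrt (1 - u^2), h v = v^2 / 4. *)
definition nondegenerate :: "real \<Rightarrow> (real \<Rightarrow> real) \<Rightarrow> real set \<Rightarrow> real \<Rightarrow> real \<Rightarrow> bool" where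
  "nondegenerate a f A C1 C3 \<longleftrightarrow>
     (a \<noteq> -1 \<longrightarrow> C3 \<noteq> 0) \<and>
     (a \<noteq> -1 \<and> a \<noteq> 0 \<and> \<not> plane_curvature (\<lambda>u. (f u, u)) constant_on A \<longrightarrow> C1 \<noteq> 0)"

end

theory Submission
  imports Defs
begin

text \<open>Both coordinate directions of a CPD patch are principal, and the patch is best described by the
tangent angles $\theta = \arctan f'(u)$ of the directrix and $\phi = \arctan h'(v)$ of the profile
curve. With the turning rates $q = \theta'(u)$ and $p = \phi'(v)$ the principal curvatures are
$q\cos\phi / (1/\cos\theta + hq)$ and $-p\cos\phi$, so that nonzero Gaussian curvature means
$p, q \neq 0$, and $N_1 A_M = a X_1 + b$ becomes
\[ \frac{1}{q} - a f - b = \Big(\frac{1}{p} - (1+a) h\Big) \cos\theta. \]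
Here $u$ and $v$ separate: the equation holds throughout the patch if and only if there is a
constant $C$ with
\[ \frac{1}{q} = a f + b + C \cos\theta, \qquad \frac{1}{p} = (1+a) h + C. \]
This is the content of \<open>cpd_equation_iff\<close> and \<open>separation_of_variables\<close>.

Since $1/q = du/d\theta$ and $df/d\theta = \tan\theta\, du/d\theta$, the first equation is a linear
differential equation for $f$ as a function of $\theta$, whose homogeneous solutions are the multiples
of $\sec^a\theta$, followed by a quadrature for $u$; the second one has the same form, with exponent
$1+a$. The curves in the claim are the general solutions, and $C_1, C_3$ are the coefficients
of the homogeneous solutions while $C_2, C_4$ are the constants of the quadratures. So the tangent
angles are the required coordinates (\<open>directrix_solution\<close>, \<open>profile_solution\<close>).

Conversely, every curve $(x, y)$ in the claim satisfies $x' = \tan t\; y'$. Its parameter is therefore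
forced to be the tangent angle, and $1/q = y'$ is the differential equation
(\<open>tangent_angle_of_parametrization\<close>). Apart from the range of the
angles, the sets $J$ and $U$ express that $y' \neq 0$ and that the
patch is regular (\<open>U_set_iff\<close>).\<close>

section \<open>Principal curvatures in a diagonal frame\<close>

text \<open>If \<open>A\<close> and \<open>B\<close> are independent eigenvectors of the shape operator with eigenvalues \<open>k1\<close> and \<open>k2\<close>, then
a tangent vector \<open>x A + y B\<close> is principal with curvature \<open>k\<close> exactly when \<open>x (k - k1) = 0\<close> and
\<open>y (k - k2) = 0\<close>. Of two independent principal vectors, one has \<open>x \<noteq> 0\<close> and one has \<open>y \<noteq> 0\<close>, so
the two curvatures are determined up to order, with the right multiplicity at umbilics.\<close>

lemma principal_curvatures_diagonal:
  assumes dX: "frechet_derivative X (at p) = (\<lambda>(x, y). x *\<^sub>R A + y *\<^sub>R B)"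
    and dN: "frechet_derivative N (at p) = (\<lambda>(x, y). - ((k1 * x) *\<^sub>R A) - (k2 * y) *\<^sub>R B)"
    and inj: "inj (frechet_derivative X (at p))"
  shows "principal_curvatures X N p l1 l2 \<longleftrightarrow> l1 = k1 \<and> l2 = k2 \<or> l1 = k2 \<and> l2 = k1"
proof -
  have indep: "x = 0 \<and> y = 0" if "x *\<^sub>R A + y *\<^sub>R B = 0" for x y
  proof -
    have "frechet_derivative X (at p) (x, y) = frechet_derivative X (at p) (0, 0)"
      using that by (simp add: dX)
    then show ?thesis using inj by (auto dest: injD)
  qed
  have coord: "curvature_in_direction X N p k t \<longleftrightarrow>
      t \<noteq> 0 \<and> (\<exists>x y. t = x *\<^sub>R A + y *\<^sub>R B \<and> x * (k - k1) = 0 \<and> y * (k - k2) = 0)" for k t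
  proof -
    have "(- ((k1 * x) *\<^sub>R A) - (k2 * y) *\<^sub>R B = - (k *\<^sub>R (x *\<^sub>R A + y *\<^sub>R B))) \<longleftrightarrow>
        (x * (k - k1)) *\<^sub>R A + (y * (k - k2)) *\<^sub>R B = 0" for x y
      by (simp add: algebra_simps)
    moreover have "(x * (k - k1)) *\<^sub>R A + (y * (k - k2)) *\<^sub>R B = 0 \<longleftrightarrow>
        x * (k - k1) = 0 \<and> y * (k - k2) = 0" for x y
      using indep by fastforce
    ultimately show ?thesis
      unfolding curvature_in_direction_def dX dN by auto
  qed
  have AB: "A \<noteq> 0" "B \<noteq> 0" "A \<noteq> B" "independent {A, B}"
  proof -
    show "A \<noteq> 0" using indep[of 1 0] by auto
    show "B \<noteq> 0" using indep[of 0 1] by auto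
    show "A \<noteq> B" using indep[of 1 "-1"] by auto
    have "A \<noteq> k *\<^sub>R B" for k using indep[of 1 "- k"] by auto
    then have "A \<notin> span {B}" by (auto simp: span_singleton)
    then show "independent {A, B}"
      using \<open>B \<noteq> 0\<close> by (simp add: independent_insert)
  qed
  have dep: False if "independent {s *\<^sub>R V, t *\<^sub>R V}" "s *\<^sub>R V \<noteq> t *\<^sub>R V" for s t and V :: "real^3"
  proof -
    have z: "s *\<^sub>R V \<noteq> 0" "t *\<^sub>R V \<noteq> 0"
      using that(1) dependent_zero[of "{s *\<^sub>R V, t *\<^sub>R V}"] by auto
    have "s *\<^sub>R V = (s / t) *\<^sub>R (t *\<^sub>R V)" using z by auto
    then have "s *\<^sub>R V \<in> span {t *\<^sub>R V}" by (metis span_base span_scale singletonI)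
    then show False
      using that independent_insert[of "s *\<^sub>R V" "{t *\<^sub>R V}"] by auto
  qed
  show ?thesis
  proof
    assume "principal_curvatures X N p l1 l2"
    then obtain t1 t2 where t: "t1 \<noteq> t2" "independent {t1, t2}"
      "curvature_in_direction X N p l1 t1" "curvature_in_direction X N p l2 t2"
      unfolding principal_curvatures_def by blast
    obtain x1 y1 where 1: "t1 \<noteq> 0" "t1 = x1 *\<^sub>R A + y1 *\<^sub>R B" "x1 * (l1 - k1) = 0" "y1 * (l1 - k2) = 0"
      using t(3) coord by auto
    obtain x2 y2 where 2: "t2 \<noteq> 0" "t2 = x2 *\<^sub>R A + y2 *\<^sub>R B" "x2 * (l2 - k1) = 0" "y2 * (l2 - k2) = 0"
      using t(4) coord by auto
    have "\<not> (y1 = 0 \<and> y2 = 0)" using dep[of x1 A x2] t(1,2) 1(2) 2(2) by auto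
    moreover have "\<not> (x1 = 0 \<and> x2 = 0)" using dep[of y1 B y2] t(1,2) 1(2) 2(2) by auto
    moreover have "\<not> (x1 = 0 \<and> y1 = 0)" "\<not> (x2 = 0 \<and> y2 = 0)" using 1 2 by auto
    ultimately show "l1 = k1 \<and> l2 = k2 \<or> l1 = k2 \<and> l2 = k1"
      using 1(3,4) 2(3,4) by auto
  next
    have "curvature_in_direction X N p k1 A" "curvature_in_direction X N p k2 B"
      unfolding coord using AB by (force intro: exI[of _ 1] exI[of _ 0])+
    moreover assume "l1 = k1 \<and> l2 = k2 \<or> l1 = k2 \<and> l2 = k1"
    ultimately show "principal_curvatures X N p l1 l2"
      unfolding principal_curvatures_def using AB by (metis insert_commute)
  qed
qed

lemma curvature_invariants_diagonal:
  assumes "frechet_derivative X (at p) = (\<lambda>(x, y). x *\<^sub>R A + y *\<^sub>R B)"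
    and "frechet_derivative N (at p) = (\<lambda>(x, y). - ((k1 * x) *\<^sub>R A) - (k2 * y) *\<^sub>R B)"
    and "inj (frechet_derivative X (at p))"
  shows "gauss_curvature X N p = k1 * k2"
    and "principal_radii_sum X N p = 1 / k1 + 1 / k2"
  unfolding gauss_curvature_def principal_radii_sum_def principal_curvatures_diagonal[OF assms]
  by (rule the_equality; auto)+

section \<open>The tangent angle of a graph\<close>

definition tangent_angle :: "(real \<Rightarrow> real) \<Rightarrow> real \<Rightarrow> real" where
  "tangent_angle f u = arctan (deriv f u)"

definition turning_rate :: "(real \<Rightarrow> real) \<Rightarrow> real \<Rightarrow> real" where
  "turning_rate f u = deriv (deriv f) u / (1 + (deriv f u)\<^sup>2)"

lemma one_plus_square_pos: "0 < 1 + (x::real)\<^sup>2"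
  by (simp add: add_pos_nonneg)

lemma tangent_angle_bounds: "tangent_angle f u \<in> {-pi/2<..<pi/2}"
  using arctan_bounded[of "deriv f u"] by (simp add: tangent_angle_def)

lemma cos_pos_half_open: "t \<in> {-pi/2<..<pi/2} \<Longrightarrow> 0 < cos t"
  by (auto intro: cos_gt_zero_pi)

lemma cos_tangent_angle: "cos (tangent_angle f u) = 1 / sqrt (1 + (deriv f u)\<^sup>2)"
  by (simp add: tangent_angle_def cos_arctan)

lemma sin_tangent_angle: "sin (tangent_angle f u) = deriv f u / sqrt (1 + (deriv f u)\<^sup>2)"
  by (simp add: tangent_angle_def sin_arctan)

lemma tan_tangent_angle: "tan (tangent_angle f u) = deriv f u"
  by (simp add: tangent_angle_def tan_arctan)

lemma C2_on_derivs:
  assumes "C2_on f A" "open A" "u \<in> A"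
  shows "(f has_real_derivative deriv f u) (at u)"
    and "(deriv f has_real_derivative deriv (deriv f) u) (at u)"
    and "(tangent_angle f has_real_derivative turning_rate f u) (at u)"
proof -
  have "f differentiable (at u)" "deriv f differentiable (at u)"
    using assms by (auto simp: C2_on_def differentiable_on_eq_differentiable_at)
  then show *: "(f has_real_derivative deriv f u) (at u)"
     "(deriv f has_real_derivative deriv (deriv f) u) (at u)"
    using DERIV_deriv_iff_real_differentiable by blast+
  show "(tangent_angle f has_real_derivative turning_rate f u) (at u)"
    unfolding tangent_angle_def[abs_def] turning_rate_def
    by (rule derivative_eq_intros *(2) refl | simp add: field_simps)+
qed

lemma coordinate_change_tangent_angle:
  assumes "C2_on f A" "open A" "\<And>u. u \<in> A \<Longrightarrow> turning_rate f u \<noteq> 0"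
  shows "coordinate_change_on (tangent_angle f) A"
proof -
  have d: "(tangent_angle f has_real_derivative turning_rate f u) (at u)" if "u \<in> A" for u
    using C2_on_derivs[OF assms(1,2) that] by simp
  then have e: "deriv (tangent_angle f) u = turning_rate f u" if "u \<in> A" for u
    using that by (simp add: DERIV_imp_deriv)
  have cf: "continuous_on A (deriv f)"
    using assms(1) differentiable_imp_continuous_on by (auto simp: C2_on_def)
  have "continuous_on A (turning_rate f)"
    unfolding turning_rate_def[abs_def] using assms(1) cf one_plus_square_pos[THEN less_imp_neq]
    by (intro continuous_intros) (auto simp: C2_on_def)
  then have "continuous_on A (deriv (tangent_angle f))"
    using e continuous_on_cong by force
  moreover have "tangent_angle f differentiable_on A"
    using d by (auto simp: differentiable_on_def real_differentiable_def
        intro: has_field_derivative_at_within)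
  ultimately show ?thesis
    using assms(3) e by (simp add: coordinate_change_on_def)
qed

section \<open>The curvatures of a CPD patch\<close>

text \<open>The argument is the tangent angle of the directrix, so \<open>normal_vec\<close> is its unit normal with negative first
component and \<open>tangent_vec\<close> its unit tangent.\<close>

definition normal_vec :: "real \<Rightarrow> real^3" where
  "normal_vec t = vector [- cos t, sin t, 0]"

definition tangent_vec :: "real \<Rightarrow> real^3" where
  "tangent_vec t = vector [sin t, cos t, 0]"

lemma vector3_axis: "(vector [x, y, z] :: real^3) = x *\<^sub>R axis 1 1 + y *\<^sub>R axis 2 1 + z *\<^sub>R axis 3 1"
  by (simp add: vec_eq_iff forall_3 axis_def)

lemma dir_normal_eq: "dir_normal f u = normal_vec (tangent_angle f u)"
  by (simp add: dir_normal_def normal_vec_def cos_tangent_angle sin_tangent_angle vec_eq_iff forall_3)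

lemma normal_vec_deriv:
  assumes "(g has_real_derivative q) (at u)"
  shows "((\<lambda>u. normal_vec (g u)) has_vector_derivative q *\<^sub>R tangent_vec (g u)) (at u)"
  unfolding normal_vec_def tangent_vec_def vector3_axis
  by (rule derivative_eq_intros assms refl | simp add: algebra_simps)+

lemma has_derivative_fst_snd:
  assumes "(g has_vector_derivative a) (at u)" "(k has_vector_derivative b) (at v)"
  shows "((\<lambda>p. g (fst p)) has_derivative (\<lambda>p. fst p *\<^sub>R a)) (at (u, v))"
    and "((\<lambda>p. k (snd p)) has_derivative (\<lambda>p. snd p *\<^sub>R b)) (at (u, v))"
proof -
  have "(fst has_derivative fst) (at (u, v))" "(snd has_derivative snd) (at (u, v))"
    by (auto intro: derivative_intros)
  then show "((\<lambda>p. g (fst p)) has_derivative (\<lambda>p. fst p *\<^sub>R a)) (at (u, v))"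
    "((\<lambda>p. k (snd p)) has_derivative (\<lambda>p. snd p *\<^sub>R b)) (at (u, v))"
    using has_derivative_compose[of fst fst "(u,v)" UNIV g] 
      has_derivative_compose[of snd snd "(u,v)" UNIV k] assms
    by (simp_all add: has_vector_derivative_def)
qed

text \<open>The two partial derivatives are the eigenvectors of the shape operator. They use the frame relation
that the derivative of \<open>normal_vec\<close> is \<open>tangent_vec\<close>, and that \<open>(f', 1, 0)\<close> is \<open>1 / cos \<theta>\<close> times the
unit tangent.\<close>

lemma cpd_param_has_derivative:
  assumes "C2_on f I" "open I" "u \<in> I" "C2_on h K" "open K" "v \<in> K"
  shows "(cpd_param f h has_derivative (\<lambda>(x, y).
      x *\<^sub>R ((1 / cos (tangent_angle f u) + h v * turning_rate f u) *\<^sub>R tangent_vec (tangent_angle f u))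
      + y *\<^sub>R (deriv h v *\<^sub>R normal_vec (tangent_angle f u) + axis 3 1))) (at (u, v))"
proof -
  note df = C2_on_derivs[OF assms(1-3)] and dh = C2_on_derivs[OF assms(4-6)]
  have base: "((\<lambda>u. vector [f u, u, 0] :: real^3) has_vector_derivative
      (1 / cos (tangent_angle f u)) *\<^sub>R tangent_vec (tangent_angle f u)) (at u)"
    using cos_pos_half_open[OF tangent_angle_bounds, of f u] tan_tangent_angle[of f u]
    unfolding vector3_axis tangent_vec_def
    by (auto intro!: derivative_eq_intros df(1) simp: tan_def scaleR_add_right)
  note n = normal_vec_deriv[OF df(3)]
  have e: "cpd_param f h = (\<lambda>p. vector [f (fst p), fst p, 0]
      + h (snd p) *\<^sub>R normal_vec (tangent_angle f (fst p)) + snd p *\<^sub>R axis 3 1)"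
    by (auto simp: cpd_param_def dir_normal_eq)
  have hv: "(h has_vector_derivative deriv h v) (at v)"
    using dh(1) has_real_derivative_iff_has_vector_derivative by blast
  note parts = has_derivative_fst_snd(1)[OF base hv] has_derivative_fst_snd(1)[OF n hv]
    has_derivative_fst_snd(2)[OF base hv]
  show ?thesis
    unfolding e
    by (rule derivative_eq_intros parts refl)+ (auto simp: algebra_simps fun_eq_iff)
qed

lemma cpd_normal_eq:
  "cpd_normal f h (u, v) = sin (tangent_angle h v) *\<^sub>R axis 3 1
     - cos (tangent_angle h v) *\<^sub>R normal_vec (tangent_angle f u)"
  by (simp add: cpd_normal_def dir_normal_eq cos_tangent_angle sin_tangent_angle
      scaleR_diff_right)

text \<open>Seen in the plane of the profile curve, the normal turns at the rate \<open>\<phi>'\<close> towards the unit vector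
\<open>cos \<phi> (h' n + e\<^sub>3)\<close>, a multiple of the partial derivative of the patch in \<open>v\<close>; in \<open>u\<close> only \<open>n\<close> turns.\<close>

lemma cpd_normal_has_derivative:
  assumes "C2_on f I" "open I" "u \<in> I" "C2_on h K" "open K" "v \<in> K"
  shows "(cpd_normal f h has_derivative (\<lambda>(x, y).
      - ((cos (tangent_angle h v) * turning_rate f u * x) *\<^sub>R tangent_vec (tangent_angle f u))
      + (turning_rate h v * cos (tangent_angle h v) * y) *\<^sub>R
          (deriv h v *\<^sub>R normal_vec (tangent_angle f u) + axis 3 1))) (at (u, v))"
proof -
  note df = C2_on_derivs[OF assms(1-3)] and dh = C2_on_derivs[OF assms(4-6)]
  have c: "((\<lambda>v. cos (tangent_angle h v)) has_vector_derivative
      - (turning_rate h v * cos (tangent_angle h v) * deriv h v)) (at v)"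
    using cos_pos_half_open[OF tangent_angle_bounds, of h v] tan_tangent_angle[of h v]
    unfolding has_real_derivative_iff_has_vector_derivative[symmetric]
    by (auto intro!: derivative_eq_intros dh(3) simp: tan_def field_simps)
  have s: "((\<lambda>v. sin (tangent_angle h v)) has_vector_derivative
      turning_rate h v * cos (tangent_angle h v)) (at v)"
    unfolding has_real_derivative_iff_has_vector_derivative[symmetric]
    by (auto intro!: derivative_eq_intros dh(3))
  note n = normal_vec_deriv[OF df(3)]
  have e: "cpd_normal f h = (\<lambda>p. sin (tangent_angle h (snd p)) *\<^sub>R axis 3 1
     - cos (tangent_angle h (snd p)) *\<^sub>R normal_vec (tangent_angle f (fst p)))"
    by (auto simp: cpd_normal_eq)
  note parts = has_derivative_fst_snd(2)[OF n c] has_derivative_fst_snd(1)[OF n c]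
    has_derivative_fst_snd(2)[OF n s]
  show ?thesis
    unfolding e
    by (rule derivative_eq_intros parts refl)+ (auto simp: algebra_simps fun_eq_iff)
qed

text \<open>The derivatives of the patch and of its normal are diagonal in the same frame, so the
principal curvatures can be read off as quotients. Regularity enters through the length of the first
frame vector, which must not vanish.\<close>

lemma cpd_curvatures:
  fixes f h :: "real \<Rightarrow> real"
  assumes smooth: "C2_on f I" "open I" "u \<in> I" "C2_on h K" "open K" "v \<in> K"
    and inj: "inj (frechet_derivative (cpd_param f h) (at (u, v)))"
  defines "\<theta> \<equiv> tangent_angle f u" and "\<phi> \<equiv> tangent_angle h v"
    and "q \<equiv> turning_rate f u" and "p \<equiv> turning_rate h v"
  shows "1 / cos \<theta> + h v * q \<noteq> 0"
    and "gauss_curvature (cpd_param f h) (cpd_normal f h) (u, v)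
           = cos \<phi> * q / (1 / cos \<theta> + h v * q) * (- (p * cos \<phi>))"
    and "principal_radii_sum (cpd_param f h) (cpd_normal f h) (u, v)
           = (1 / cos \<theta> + h v * q) / (cos \<phi> * q) - 1 / (p * cos \<phi>)"
proof -
  define l where "l = 1 / cos \<theta> + h v * q"
  define B where "B = deriv h v *\<^sub>R normal_vec \<theta> + axis 3 1"
  have dX: "frechet_derivative (cpd_param f h) (at (u, v)) = (\<lambda>(x, y). x *\<^sub>R (l *\<^sub>R tangent_vec \<theta>) + y *\<^sub>R B)"
    using frechet_derivative_at[OF cpd_param_has_derivative[OF smooth]]
    by (simp add: l_def B_def \<theta>_def q_def)
  show l0: "1 / cos \<theta> + h v * q \<noteq> 0"
  proof
    assume "1 / cos \<theta> + h v * q = 0"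
    then have "frechet_derivative (cpd_param f h) (at (u, v)) (1, 0)
        = frechet_derivative (cpd_param f h) (at (u, v)) (0, 0)"
      by (simp add: dX l_def)
    then show False using inj by (auto dest: injD)
  qed
  have dN: "frechet_derivative (cpd_normal f h) (at (u, v)) =
      (\<lambda>(x, y). - ((cos \<phi> * q / l * x) *\<^sub>R (l *\<^sub>R tangent_vec \<theta>)) - ((- (p * cos \<phi>)) * y) *\<^sub>R B)"
    unfolding frechet_derivative_at[OF cpd_normal_has_derivative[OF smooth], symmetric]
    using l0 unfolding l_def[symmetric]
    by (auto simp: B_def \<theta>_def[symmetric] q_def p_def \<phi>_def algebra_simps)
  from curvature_invariants_diagonal[OF dX dN inj]
  show "gauss_curvature (cpd_param f h) (cpd_normal f h) (u, v)
           = cos \<phi> * q / (1 / cos \<theta> + h v * q) * (- (p * cos \<phi>))"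
    and "principal_radii_sum (cpd_param f h) (cpd_normal f h) (u, v)
           = (1 / cos \<theta> + h v * q) / (cos \<phi> * q) - 1 / (p * cos \<phi>)"
    by (simp_all add: l_def)
qed

lemma cpd_first_components:
  "cpd_normal f h (u, v) \<bullet> axis 1 1 = cos (tangent_angle f u) * cos (tangent_angle h v)"
  "cpd_param f h (u, v) \<bullet> axis 1 1 = f u - h v * cos (tangent_angle f u)"
proof -
  have "axis 3 (1::real) $ (1::3) = 0" by (simp add: axis_def)
  then show "cpd_normal f h (u, v) \<bullet> axis 1 1 = cos (tangent_angle f u) * cos (tangent_angle h v)"
    "cpd_param f h (u, v) \<bullet> axis 1 1 = f u - h v * cos (tangent_angle f u)"
    by (simp_all add: inner_axis cpd_normal_eq cpd_param_def dir_normal_eq normal_vec_def)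
qed

text \<open>The product \<open>cos \<theta> cos \<phi>\<close> of the angle function cancels the factor \<open>1 / cos \<phi>\<close> common to both radii;
the rest is a rearrangement that leaves \<open>u\<close> and \<open>v\<close> coupled only through the product on the right.\<close>

lemma cpd_equation_iff:
  assumes smooth: "C2_on f I" "open I" "u \<in> I" "C2_on h K" "open K" "v \<in> K"
    and inj: "inj (frechet_derivative (cpd_param f h) (at (u, v)))"
    and ne: "turning_rate f u \<noteq> 0" "turning_rate h v \<noteq> 0"
  shows "(cpd_normal f h (u, v) \<bullet> axis 1 1) * principal_radii_sum (cpd_param f h) (cpd_normal f h) (u, v)
           = a * (cpd_param f h (u, v) \<bullet> axis 1 1) + b \<longleftrightarrow>
         1 / turning_rate f u - a * f u - b
           = (1 / turning_rate h v - (1 + a) * h v) * cos (tangent_angle f u)"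
proof -
  have "cos (tangent_angle f u) \<noteq> 0" "cos (tangent_angle h v) \<noteq> 0"
    using cos_pos_half_open[OF tangent_angle_bounds] by (metis less_irrefl)+
  then have "(cpd_normal f h (u, v) \<bullet> axis 1 1) * principal_radii_sum (cpd_param f h) (cpd_normal f h) (u, v)
     = 1 / turning_rate f u + h v * cos (tangent_angle f u) - cos (tangent_angle f u) / turning_rate h v"
    unfolding cpd_curvatures(3)[OF smooth inj] cpd_first_components using ne by (simp add: field_simps)
  then show ?thesis
    unfolding cpd_first_components by (auto simp: algebra_simps)
qed

section \<open>Curves parametrized by the tangent angle\<close>

lemma sec_pos: "t \<in> {-pi/2<..<pi/2} \<Longrightarrow> 0 < sec t"
  by (simp add: sec_def cos_pos_half_open)

lemma sec_powr_deriv: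
  assumes "t \<in> {-pi/2<..<pi/2}"
  shows "((\<lambda>t. sec t powr m) has_real_derivative m * tan t * sec t powr m) (at t)"
proof -
  have c: "0 < cos t" using cos_pos_half_open[OF assms] .
  have "(sec has_real_derivative tan t * sec t) (at t)"
    unfolding sec_def[abs_def] using c
    by (auto intro!: derivative_eq_intros simp: tan_def power2_eq_square)
  from DERIV_fun_powr[OF this sec_pos[OF assms], of m] show ?thesis
    using sec_pos[OF assms] by (simp add: powr_diff mult_ac)
qed

text \<open>Here the parameter \<open>t\<close> is the angle of the tangent line with the second axis, so \<open>\<bar>r t\<bar> / cos t\<close> is
the radius of curvature. The sign comes from the choice of the normal with negative first component.\<close>

lemma tangent_angle_curve_curvature:
  assumes t: "t \<in> {-pi/2<..<pi/2}"
    and x: "\<And>t. t \<in> {-pi/2<..<pi/2} \<Longrightarrow> ((\<lambda>t. fst (c t)) has_real_derivative tan t * r t) (at t)"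
    and y: "\<And>t. t \<in> {-pi/2<..<pi/2} \<Longrightarrow> ((\<lambda>t. snd (c t)) has_real_derivative r t) (at t)"
    and r: "(r has_real_derivative r') (at t)"
  shows "plane_curvature c t = - cos t / r t"
proof -
  have c: "cos t > 0" using cos_pos_half_open[OF t] .
  have ev: "\<forall>\<^sub>F s in nhds t. s \<in> {-pi/2<..<pi/2}"
    using t by (intro eventually_nhds_in_open) auto
  have dx: "deriv (\<lambda>t. fst (c t)) s = tan s * r s" and dy: "deriv (\<lambda>t. snd (c t)) s = r s"
    if "s \<in> {-pi/2<..<pi/2}" for s
    using x[OF that] y[OF that] by (simp_all add: DERIV_imp_deriv)
  have "deriv (deriv (\<lambda>t. snd (c t))) t = deriv r t"
    by (intro deriv_cong_ev eventually_mono[OF ev] dy refl)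
  then have ddy: "deriv (deriv (\<lambda>t. snd (c t))) t = r'"
    using r by (simp add: DERIV_imp_deriv)
  have "deriv (deriv (\<lambda>t. fst (c t))) t = deriv (\<lambda>t. tan t * r t) t"
    by (intro deriv_cong_ev eventually_mono[OF ev] dx refl)
  also have "\<dots> = inverse ((cos t)\<^sup>2) * r t + tan t * r'"
    by (intro DERIV_imp_deriv) (use c in \<open>auto intro!: derivative_eq_intros r\<close>)
  finally have ddx: "deriv (deriv (\<lambda>t. fst (c t))) t = inverse ((cos t)\<^sup>2) * r t + tan t * r'" .
  have "(tan t * r t)\<^sup>2 + (r t)\<^sup>2 = (r t / cos t)\<^sup>2 * ((sin t)\<^sup>2 + (cos t)\<^sup>2)"
    using c by (simp only: tan_def) (simp add: field_simps del: sin_cos_squared_add sin_cos_squared_add2)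
  then have "(tan t * r t)\<^sup>2 + (r t)\<^sup>2 = (r t / cos t)\<^sup>2" by simp
  then have len: "sqrt ((tan t * r t)\<^sup>2 + (r t)\<^sup>2) = \<bar>r t\<bar> / cos t"
    using c by simp
  show ?thesis
    unfolding plane_curvature_def Let_def dx[OF t] dy[OF t] ddx ddy len
    using c by (cases "r t" "0::real" rule: linorder_cases)
       (auto simp: field_simps power2_eq_square power3_eq_cube)
qed

lemma graph_curvature:
  assumes "C2_on f I" "open I" "u \<in> I"
  shows "plane_curvature (\<lambda>u. (f u, u)) u = - turning_rate f u * cos (tangent_angle f u)"
proof -
  have "deriv (\<lambda>x::real. x) = (\<lambda>x. 1)" by (auto intro!: DERIV_imp_deriv)
  moreover have "deriv (\<lambda>x::real. 1::real) = (\<lambda>x. 0)" by (auto intro!: DERIV_imp_deriv)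
  moreover have "sqrt (1 + (deriv f u)\<^sup>2) ^ 3 = (1 + (deriv f u)\<^sup>2) * sqrt (1 + (deriv f u)\<^sup>2)"
    by (simp add: power3_eq_cube)
  ultimately show ?thesis
    by (simp add: plane_curvature_def Let_def turning_rate_def cos_tangent_angle add.commute)
qed

text \<open>Differentiating \<open>u = y (\<Theta> u)\<close> and \<open>f u = x (\<Theta> u)\<close> gives \<open>r \<Theta>' = 1\<close> and \<open>f' = tan \<Theta>\<close>. Hence the
parameter is not a free choice: it is the tangent angle, and \<open>r\<close> is the inverse of the turning rate.\<close>

lemma tangent_angle_of_parametrization:
  assumes A: "open A" and \<Theta>: "coordinate_change_on \<Theta> A"
    and range: "\<And>u. u \<in> A \<Longrightarrow> \<Theta> u \<in> {-pi/2<..<pi/2}"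
    and x: "\<And>t. t \<in> {-pi/2<..<pi/2} \<Longrightarrow> ((\<lambda>t. fst (c t)) has_real_derivative tan t * r t) (at t)"
    and y: "\<And>t. t \<in> {-pi/2<..<pi/2} \<Longrightarrow> ((\<lambda>t. snd (c t)) has_real_derivative r t) (at t)"
    and eq: "\<And>u. u \<in> A \<Longrightarrow> (f u, u) = c (\<Theta> u)" and u: "u \<in> A"
  shows "\<Theta> u = tangent_angle f u" and "1 / turning_rate f u = r (\<Theta> u)"
proof -
  have ev: "\<forall>\<^sub>F s in nhds u. s \<in> A" if "u \<in> A" for u
    using that A by (intro eventually_nhds_in_open)
  have d\<Theta>: "(\<Theta> has_real_derivative deriv \<Theta> u) (at u)" if "u \<in> A" for u
    using \<Theta> that A DERIV_deriv_iff_real_differentiable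
    by (auto simp: coordinate_change_on_def differentiable_on_eq_differentiable_at)
  have *: "r (\<Theta> u) * deriv \<Theta> u = 1 \<and> deriv f u = tan (\<Theta> u)" if u: "u \<in> A" for u
  proof -
    have "((\<lambda>u. snd (c (\<Theta> u))) has_real_derivative r (\<Theta> u) * deriv \<Theta> u) (at u)"
      using DERIV_chain2[OF y[OF range[OF u]] d\<Theta>[OF u]] .
    moreover have "\<forall>\<^sub>F s in nhds u. snd (c (\<Theta> s)) = s"
      using ev[OF u] by eventually_elim (metis eq snd_conv)
    ultimately have "((\<lambda>u. u) has_real_derivative r (\<Theta> u) * deriv \<Theta> u) (at u)"
      using DERIV_cong_ev[of u u "\<lambda>u. snd (c (\<Theta> u))" "\<lambda>u. u"] by simp
    then have 1: "r (\<Theta> u) * deriv \<Theta> u = 1"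
      using DERIV_unique[OF _ DERIV_ident] by blast
    have "((\<lambda>u. fst (c (\<Theta> u))) has_real_derivative tan (\<Theta> u) * r (\<Theta> u) * deriv \<Theta> u) (at u)"
      using DERIV_chain2[OF x[OF range[OF u]] d\<Theta>[OF u]] .
    moreover have "\<forall>\<^sub>F s in nhds u. fst (c (\<Theta> s)) = f s"
      using ev[OF u] by eventually_elim (metis eq fst_conv)
    ultimately have "(f has_real_derivative tan (\<Theta> u) * r (\<Theta> u) * deriv \<Theta> u) (at u)"
      using DERIV_cong_ev[of u u "\<lambda>u. fst (c (\<Theta> u))" f] by simp
    then show ?thesis using 1 by (simp add: DERIV_imp_deriv mult.assoc)
  qed
  then show "\<Theta> u = tangent_angle f u"
    using range[OF u] u by (simp add: tangent_angle_def arctan_tan)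
  have "\<forall>\<^sub>F s in nhds u. deriv f s = tan (\<Theta> s)"
    using ev[OF u] by eventually_elim (simp add: *)
  then have "deriv (deriv f) u = deriv (\<lambda>s. tan (\<Theta> s)) u"
    by (intro deriv_cong_ev refl)
  also have "\<dots> = inverse ((cos (\<Theta> u))\<^sup>2) * deriv \<Theta> u"
    by (rule DERIV_imp_deriv, rule DERIV_chain2[OF DERIV_tan d\<Theta>[OF u]])
      (use cos_pos_half_open[OF range[OF u]] in auto)
  finally have "turning_rate f u = inverse ((cos (\<Theta> u))\<^sup>2) * deriv \<Theta> u / (1 + (tan (\<Theta> u))\<^sup>2)"
    using * u by (simp add: turning_rate_def)
  also have "\<dots> = deriv \<Theta> u"
    using cos_pos_half_open[OF range[OF u]] by (simp add: tan_sec power_inverse)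
  finally show "1 / turning_rate f u = r (\<Theta> u)"
    using * u by (metis mult_zero_right nonzero_eq_divide_eq zero_neq_one)
qed

text \<open>The hypothesis on \<open>f\<close> says that, as a function of the tangent angle \<open>t\<close>, it satisfies
\<open>df/dt = tan t (m f + g t)\<close>. Any solution differs from a particular one \<open>x0\<close> by a solution of the
homogeneous equation \<open>de/dt = m tan t e\<close>, for which \<open>sec powr (- m)\<close> is an integrating factor.\<close>

lemma linear_tangent_angle_ode:
  assumes smooth: "C2_on f A" "open A" and A: "is_interval A"
    and x0: "\<And>t. t \<in> {-pi/2<..<pi/2} \<Longrightarrow> (x0 has_real_derivative tan t * (m * x0 t + g t)) (at t)"
    and eq: "\<And>u. u \<in> A \<Longrightarrow> turning_rate f u * (m * f u + g (tangent_angle f u)) = 1"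
  obtains c where "\<And>u. u \<in> A \<Longrightarrow> f u = x0 (tangent_angle f u) + c * sec (tangent_angle f u) powr m"
proof -
  let ?\<theta> = "tangent_angle f"
  \<comment> \<open>The difference from the particular solution, times the integrating factor.\<close>
  let ?e = "\<lambda>u. (f u - x0 (?\<theta> u)) * sec (?\<theta> u) powr (- m)"
  have "(?e has_real_derivative 0) (at u)" if u: "u \<in> A" for u
  proof -
    note d = C2_on_derivs[OF smooth u]
    note d1 = DERIV_chain2[OF x0[OF tangent_angle_bounds] d(3)]
    note d2 = DERIV_chain2[OF sec_powr_deriv[OF tangent_angle_bounds] d(3), of "- m"]
    have f': "deriv f u = tan (?\<theta> u) * (m * f u + g (?\<theta> u)) * turning_rate f u"
      using eq[OF u] by (simp add: tan_tangent_angle mult_ac)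
    show ?thesis
      by (rule derivative_eq_intros d(1) d1 d2 refl)+ (unfold f', simp add: algebra_simps)
  qed
  then have "\<exists>c. \<forall>u\<in>A. ?e u = c"
    by (intro has_field_derivative_zero_constant is_interval_convex[OF A])
      (auto intro: has_field_derivative_at_within)
  then obtain c where c: "\<And>u. u \<in> A \<Longrightarrow> ?e u = c" by blast
  show thesis
  proof
    fix u assume "u \<in> A"
    moreover have "sec (?\<theta> u) powr (- m) * sec (?\<theta> u) powr m = 1"
      using sec_pos[OF tangent_angle_bounds, of f u] by (simp add: powr_minus)
    ultimately show "f u = x0 (?\<theta> u) + c * sec (?\<theta> u) powr m"
      using c[of u] by (metis diff_add_cancel add.commute mult.assoc mult.right_neutral)
  qed
qed

text \<open>The quadrature: the hypothesis on \<open>r\<close> says that \<open>du/dt = r t\<close> along the graph, where \<open>t\<close> is its tangent angle.\<close>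

lemma abscissa_from_tangent_angle:
  assumes smooth: "C2_on f A" "open A" and A: "is_interval A"
    and y: "\<And>t. t \<in> {-pi/2<..<pi/2} \<Longrightarrow> (y has_real_derivative r t) (at t)"
    and eq: "\<And>u. u \<in> A \<Longrightarrow> turning_rate f u * r (tangent_angle f u) = 1"
  obtains c where "\<And>u. u \<in> A \<Longrightarrow> u = c + y (tangent_angle f u)"
proof -
  let ?e = "\<lambda>u. u - y (tangent_angle f u)"
  have "(?e has_real_derivative 0) (at u)" if u: "u \<in> A" for u
    by (rule derivative_eq_intros
         DERIV_chain2[OF y[OF tangent_angle_bounds] C2_on_derivs(3)[OF smooth u]] refl)+
      (simp add: eq[OF u] mult.commute)
  then have "\<exists>c. \<forall>u\<in>A. ?e u = c"
    by (intro has_field_derivative_zero_constant is_interval_convex[OF A])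
      (auto intro: has_field_derivative_at_within)
  then obtain c where c: "\<And>u. u \<in> A \<Longrightarrow> ?e u = c" by blast
  show thesis by (rule that[of c]) (use c in force)
qed

section \<open>The two families of curves\<close>

text \<open>In all three cases the directrix is a solution of \<open>x' = tan t (a x + b + C cos t)\<close> together with
\<open>y' = a x + b + C cos t\<close>; the differential equations for the
surface lead to exactly this form.\<close>

lemma directrix_derivs:
  fixes a b C C1 C2 t :: real
  assumes S: "sec_power_antiderivative a S" and t: "t \<in> {-pi/2<..<pi/2}"
  defines "r \<equiv> \<lambda>t. a * fst (directrix a b S C C1 C2 t) + b + C * cos t"
  shows "((\<lambda>t. fst (directrix a b S C C1 C2 t)) has_real_derivative tan t * r t) (at t)"
    and "((\<lambda>t. snd (directrix a b S C C1 C2 t)) has_real_derivative r t) (at t)"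
proof -
  have c: "0 < cos t" using cos_pos_half_open[OF t] .
  consider "a = 0" | "a = -1" | "a \<noteq> 0" "a \<noteq> -1" by blast
  then have "((\<lambda>t. fst (directrix a b S C C1 C2 t)) has_real_derivative tan t * r t) (at t) \<and>
     ((\<lambda>t. snd (directrix a b S C C1 C2 t)) has_real_derivative r t) (at t)"
  proof cases
    case 1
    then show ?thesis using c
      by (auto simp: directrix_def r_def tan_def field_simps intro!: derivative_eq_intros)
  next
    case 2
    have "- 1 < sin t"
      using t by (metis c cos_squared_eq less_eq_real_def not_less power2_minus power_one
          sin_ge_minus_one diff_self zero_less_power)
    then have st: "0 < sec t + tan t"
      using c by (simp add: sec_def tan_def add_divide_distrib[symmetric])
    \<comment> \<open>The antiderivative of the secant; its argument is positive because \<open>sin t > - 1\<close>.\<close>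
    have dl: "((\<lambda>t. ln (sec t + tan t)) has_real_derivative 1 / cos t) (at t)"
    proof -
      have "((\<lambda>t. sec t + tan t) has_real_derivative (sec t + tan t) / cos t) (at t)"
        unfolding sec_def tan_def using c
        by (auto intro!: derivative_eq_intros simp: field_simps power2_eq_square)
      from DERIV_ln_divide[THEN DERIV_chain2, OF st this] show ?thesis using st by simp
    qed
    have s2: "sin t * sin t = 1 - cos t * cos t"
      using sin_squared_eq[of t] by (simp add: power2_eq_square)
    have "((\<lambda>t. fst (directrix a b S C C1 C2 t)) has_real_derivative tan t * r t) (at t)"
      using c 2 by (auto intro!: derivative_eq_intros simp: directrix_def r_def tan_def field_simps)
    moreover have "((\<lambda>t. C2 - C1 * sin t + C * (sin t * ln (cos t) + ln (sec t + tan t)))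
        has_real_derivative r t) (at t)"
      by (rule dl derivative_eq_intros refl c)+
        (use c 2 in \<open>simp add: directrix_def r_def field_simps s2\<close>)
    ultimately show ?thesis using 2 by (simp add: directrix_def)
  next
    case 3
    have S': "(S has_real_derivative sec t powr a) (at t)"
      using S t by (simp add: sec_power_antiderivative_def)
    \<comment> \<open>Writing \<open>C\<close> as \<open>d (a + 1)\<close> removes the denominators \<open>a + 1\<close>.\<close>
    define d where "d = C / (a + 1)"
    have C: "C = d * (a + 1)" using 3 by (simp add: d_def add_eq_0_iff)
    have r: "r t = a * C1 * sec t powr a + d * cos t"
      using 3 by (simp add: r_def directrix_def flip: d_def) (simp add: C algebra_simps)
    show ?thesis
      unfolding r directrix_def
      by (simp add: 3 flip: d_def, intro conjI; (rule sec_powr_deriv[OF t] S' derivative_eq_intros refl)+)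
        (use c in \<open>simp_all add: tan_def field_simps\<close>)
  qed
  then show "((\<lambda>t. fst (directrix a b S C C1 C2 t)) has_real_derivative tan t * r t) (at t)"
    and "((\<lambda>t. snd (directrix a b S C C1 C2 t)) has_real_derivative r t) (at t)" by auto
qed

text \<open>The same system as for the directrix, with \<open>1 + a\<close> in place of \<open>a\<close> and a constant inhomogeneity.\<close>

lemma profile_derivs:
  fixes a C C3 C4 s :: real
  assumes T: "sec_power_antiderivative (1 + a) T" and s: "s \<in> {-pi/2<..<pi/2}"
  defines "r \<equiv> \<lambda>s. (1 + a) * fst (profile a T C C3 C4 s) + C"
  shows "((\<lambda>s. fst (profile a T C C3 C4 s)) has_real_derivative tan s * r s) (at s)"
    and "((\<lambda>s. snd (profile a T C C3 C4 s)) has_real_derivative r s) (at s)"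
proof -
  have c: "0 < cos s" using cos_pos_half_open[OF s] .
  have T': "(T has_real_derivative sec s powr (1 + a)) (at s)"
    using T s by (simp add: sec_power_antiderivative_def)
  have "((\<lambda>s. fst (profile a T C C3 C4 s)) has_real_derivative tan s * r s) (at s) \<and>
      ((\<lambda>s. snd (profile a T C C3 C4 s)) has_real_derivative r s) (at s)"
  proof (cases "a = -1")
    case True
    then show ?thesis using c
      by (auto intro!: derivative_eq_intros simp: profile_def r_def tan_def field_simps)
  next
    case False
    define d where "d = C / (a + 1)"
    have C: "C = d * (a + 1)" using False by (simp add: d_def add_eq_0_iff)
    have r: "r s = (1 + a) * C3 * sec s powr (1 + a)"
      using False by (simp add: r_def profile_def flip: d_def) (simp add: C algebra_simps)
    show ?thesis
      unfolding r profile_def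
      by (simp add: False flip: d_def, intro conjI; (rule sec_powr_deriv[OF s] T' derivative_eq_intros refl)+)
        (simp_all add: algebra_simps)
  qed
  then show "((\<lambda>s. fst (profile a T C C3 C4 s)) has_real_derivative tan s * r s) (at s)"
    and "((\<lambda>s. snd (profile a T C C3 C4 s)) has_real_derivative r s) (at s)" by auto
qed

text \<open>The constants \<open>C1\<close> and \<open>C2\<close> parametrize the solutions affinely, again uniformly in the three cases:
\<open>C1 sec powr a\<close> is \<open>C1\<close> for \<open>a = 0\<close> and \<open>C1 cos t\<close> for \<open>a = -1\<close>.\<close>

lemma directrix_shift:
  assumes "t \<in> {-pi/2<..<pi/2}"
  shows "directrix a b S C C1 C2 t =
    (fst (directrix a b S C 0 0 t) + C1 * sec t powr a, C2 + snd (directrix a b S C C1 0 t))"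
  using sec_pos[OF assms] by (auto simp: directrix_def powr_minus) (auto simp: sec_def)

lemma profile_shift:
  assumes "s \<in> {-pi/2<..<pi/2}"
  shows "profile a T C C3 C4 s =
    (fst (profile a T C 0 0 s) + C3 * sec s powr (1 + a), C4 + snd (profile a T C C3 0 s))"
  using sec_pos[OF assms] by (auto simp: profile_def)

text \<open>The expression that defines the set \<open>J\<close> is \<open>y' / cos t\<close>, where \<open>y\<close> is the second component of the
directrix. Thus \<open>J\<close> is where the directrix is locally a graph over the second axis.\<close>

lemma J_set_iff:
  "t \<in> J_set a b C C1 \<longleftrightarrow> t \<in> {-pi/2<..<pi/2} \<and>
     a * fst (directrix a b S C C1 C2 t) + b + C * cos t \<noteq> 0"
proof (cases "t \<in> {-pi/2<..<pi/2}")
  case True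
  then have c: "0 < cos t" by (rule cos_pos_half_open)
  have p: "sec t powr (a + 1) * cos t = sec t powr a"
    using sec_pos[OF True] c by (simp add: powr_add sec_def)
  have "a * fst (directrix a b S C C1 C2 t) + b + C * cos t = cos t *
     (if a = 0 then b * sec t + C
     else if a = -1 then C * (1 + ln (cos t)) - C1
     else a * C1 * sec t powr (a + 1) + C / (a + 1))"
  proof (cases "a = 0 \<or> a = -1")
    case True
    then show ?thesis using c by (auto simp: directrix_def sec_def algebra_simps)
  next
    case False
    define d where "d = C / (a + 1)"
    have C: "C = d * (a + 1)" using False by (simp add: d_def add_eq_0_iff)
    show ?thesis
      using False by (simp add: directrix_def flip: d_def p) (simp add: C algebra_simps)
  qed
  then show ?thesis using c True by (simp add: J_set_def split: if_splits)
next
  case False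
  then show ?thesis unfolding J_set_def by blast
qed

lemma directrix_curvature:
  assumes S: "sec_power_antiderivative a S" and t: "t \<in> {-pi/2<..<pi/2}"
  shows "plane_curvature (directrix a b S C C1 C2) t
           = - cos t / (a * fst (directrix a b S C C1 C2 t) + b + C * cos t)"
  by (rule tangent_angle_curve_curvature[OF t directrix_derivs[OF S]])
    (auto intro!: derivative_eq_intros directrix_derivs(1)[OF S t])

lemma U_set_iff:
  assumes S: "sec_power_antiderivative a S"
  shows "(t, s) \<in> U_set a b S T C C1 C2 C3 C4 \<longleftrightarrow>
     t \<in> {-pi/2<..<pi/2} \<and> s \<in> {-pi/2<..<pi/2} \<and>
     a * fst (directrix a b S C C1 C2 t) + b + C * cos t \<noteq> 0 \<and>
     1 + cos t / (a * fst (directrix a b S C C1 C2 t) + b + C * cos t)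
       * fst (profile a T C C3 C4 s) \<noteq> 0"
  unfolding U_set_def
  by (auto simp: J_set_iff[where S = S and ?C2.0 = C2] directrix_curvature[OF S])

section \<open>Separation of variables\<close>

text \<open>Fixing one point of \<open>A\<close> shows that \<open>F\<close> is constant.\<close>

lemma separation_of_variables:
  fixes E w :: "'a \<Rightarrow> real" and F :: "'b \<Rightarrow> real"
  assumes "\<And>u. u \<in> A \<Longrightarrow> w u \<noteq> 0" "A \<noteq> {}" "B \<noteq> {}"
  shows "(\<forall>u\<in>A. \<forall>v\<in>B. E u = F v * w u) \<longleftrightarrow>
         (\<exists>C. (\<forall>u\<in>A. E u = C * w u) \<and> (\<forall>v\<in>B. F v = C))"
  using assms
  by (smt (verit) all_not_in_conv mult_right_cancel)

text \<open>The differential equation determines \<open>f\<close> as a function of the tangent angle up to \<open>C1\<close>, and then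
\<open>du/d\<theta> = a f + b + C cos \<theta>\<close> determines \<open>u\<close> up to \<open>C2\<close>.\<close>

lemma directrix_solution:
  assumes S: "sec_power_antiderivative a S"
    and smooth: "C2_on f I" "open I" and I: "is_interval I"
    and ne: "\<And>u. u \<in> I \<Longrightarrow> turning_rate f u \<noteq> 0"
    and ode: "\<And>u. u \<in> I \<Longrightarrow> 1 / turning_rate f u = a * f u + b + C * cos (tangent_angle f u)"
  obtains C1 C2 where "\<And>u. u \<in> I \<Longrightarrow> (f u, u) = directrix a b S C C1 C2 (tangent_angle f u)"
proof -
  have ode': "turning_rate f u * (a * f u + (b + C * cos (tangent_angle f u))) = 1" if "u \<in> I" for u
    using ode[OF that] ne[OF that] by (simp add: field_simps)
  have x0: "((\<lambda>t. fst (directrix a b S C 0 0 t)) has_real_derivative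
      tan t * (a * fst (directrix a b S C 0 0 t) + (b + C * cos t))) (at t)"
    if "t \<in> {-pi/2<..<pi/2}" for t
    using directrix_derivs(1)[OF S that] by (simp add: add.assoc)
  obtain C1 where C1: "\<And>u. u \<in> I \<Longrightarrow>
      f u = fst (directrix a b S C 0 0 (tangent_angle f u)) + C1 * sec (tangent_angle f u) powr a"
    using linear_tangent_angle_ode[OF smooth I x0 ode'] by blast
  have f: "f u = fst (directrix a b S C C1 d (tangent_angle f u))" if "u \<in> I" for u d
    using C1[OF that] directrix_shift[OF tangent_angle_bounds, of a b S C C1 d f u] by simp
  have r: "turning_rate f u * (a * fst (directrix a b S C C1 0 (tangent_angle f u)) + b
      + C * cos (tangent_angle f u)) = 1" if "u \<in> I" for u
    using ode'[OF that] f[OF that, of 0] by (simp add: add.assoc)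
  obtain d where d: "\<And>u. u \<in> I \<Longrightarrow> u = d + snd (directrix a b S C C1 0 (tangent_angle f u))"
    using abscissa_from_tangent_angle[OF smooth I directrix_derivs(2)[OF S] r] by blast
  show thesis
  proof
    fix u assume "u \<in> I"
    then show "(f u, u) = directrix a b S C C1 d (tangent_angle f u)"
      using f[of u d] d[of u] directrix_shift[OF tangent_angle_bounds, of a b S C C1 d f u]
      by (metis prod.collapse snd_conv)
  qed
qed

lemma profile_solution:
  assumes T: "sec_power_antiderivative (1 + a) T"
    and smooth: "C2_on h K" "open K" and K: "is_interval K"
    and ne: "\<And>v. v \<in> K \<Longrightarrow> turning_rate h v \<noteq> 0"
    and ode: "\<And>v. v \<in> K \<Longrightarrow> 1 / turning_rate h v = (1 + a) * h v + C"
  obtains C3 C4 where "\<And>v. v \<in> K \<Longrightarrow> (h v, v) = profile a T C C3 C4 (tangent_angle h v)"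
proof -
  have ode': "turning_rate h v * ((1 + a) * h v + C) = 1" if "v \<in> K" for v
    using ode[OF that] ne[OF that] by (simp add: field_simps)
  obtain C3 where C3: "\<And>v. v \<in> K \<Longrightarrow>
      h v = fst (profile a T C 0 0 (tangent_angle h v)) + C3 * sec (tangent_angle h v) powr (1 + a)"
    using linear_tangent_angle_ode[OF smooth K profile_derivs(1)[OF T] ode'] by blast
  have h: "h v = fst (profile a T C C3 d (tangent_angle h v))" if "v \<in> K" for v d
    using C3[OF that] profile_shift[OF tangent_angle_bounds, of a T C C3 d h v] by simp
  have r: "turning_rate h v * ((1 + a) * fst (profile a T C C3 0 (tangent_angle h v)) + C) = 1"
    if "v \<in> K" for v
    using ode'[OF that] h[OF that, of 0] by simp
  obtain d where d: "\<And>v. v \<in> K \<Longrightarrow> v = d + snd (profile a T C C3 0 (tangent_angle h v))"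
    using abscissa_from_tangent_angle[OF smooth K profile_derivs(2)[OF T] r] by blast
  show thesis
  proof
    fix v assume "v \<in> K"
    then show "(h v, v) = profile a T C C3 d (tangent_angle h v)"
      using h[of v d] d[of v] profile_shift[OF tangent_angle_bounds, of a T C C3 d h v]
      by (metis prod.collapse snd_conv)
  qed
qed

text \<open>For \<open>a \<noteq> -1\<close>, if \<open>C3 = 0\<close> then \<open>h\<close> is the constant solution \<open>- C / (a + 1)\<close>, for which
\<open>(1 + a) h + C\<close> vanishes, whereas it should be the inverse of the turning rate. If
\<open>C1 = 0\<close> and \<open>a\<close> is neither \<open>0\<close> nor \<open>-1\<close>, the directrix is an arc of a circle of radius
\<open>\<bar>C / (a + 1)\<bar>\<close>.\<close>

lemma nondegenerate_tangent_angle_curves: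
  assumes smooth: "C2_on f I" "open I"
    and neh: "turning_rate h v \<noteq> 0"
    and odef: "\<And>u. u \<in> I \<Longrightarrow> 1 / turning_rate f u = a * f u + b + C * cos (tangent_angle f u)"
    and odeh: "1 / turning_rate h v = (1 + a) * h v + C"
    and f: "\<And>u. u \<in> I \<Longrightarrow> (f u, u) = directrix a b S C C1 C2 (tangent_angle f u)"
    and h: "(h v, v) = profile a T C C3 C4 (tangent_angle h v)"
  shows "nondegenerate a f I C1 C3"
  unfolding nondegenerate_def
proof (intro conjI impI notI)
  assume a: "a \<noteq> -1" and "C3 = 0"
  then have "h v = - C / (a + 1)" using h by (metis profile_def fst_conv mult_zero_left diff_0 minus_divide_left)
  moreover have "a + 1 \<noteq> 0" using a by linarith
  ultimately have "(1 + a) * h v + C = 0" by (simp add: field_simps)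
  then show False using odeh neh by simp
next
  assume a: "a \<noteq> -1 \<and> a \<noteq> 0 \<and> \<not> plane_curvature (\<lambda>u. (f u, u)) constant_on I" and "C1 = 0"
  then have a1: "a + 1 \<noteq> 0" by linarith
  have "plane_curvature (\<lambda>u. (f u, u)) u = - (a + 1) / C" if u: "u \<in> I" for u
  proof -
    let ?t = "tangent_angle f u"
    have c: "0 < cos ?t" using cos_pos_half_open[OF tangent_angle_bounds] .
    have "f u = - C / (a + 1) * cos ?t - b / a"
      using f[OF u] a \<open>C1 = 0\<close> by (simp add: directrix_def)
    then have "a * f u + b = - (a * C / (a + 1)) * cos ?t"
      using a by (simp add: right_diff_distrib)
    moreover have "C - a * C / (a + 1) = C / (a + 1)" using a1 by (simp add: field_simps)
    ultimately have "1 / turning_rate f u = C / (a + 1) * cos ?t"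
      using odef[OF u] by (metis add.commute left_diff_distrib uminus_add_conv_diff mult_minus_left)
    then have "turning_rate f u = (a + 1) / (C * cos ?t)"
      using a1 c by (metis divide_divide_eq_left divide_divide_eq_right div_by_1 mult_1 times_divide_eq_left)
    then show ?thesis using graph_curvature[OF smooth u] c by (simp add: minus_divide_left)
  qed
  then have "plane_curvature (\<lambda>u. (f u, u)) constant_on I"
    unfolding constant_on_def by blast
  with a show False by blast
qed

section \<open>The classification\<close>

theorem theorem4p1:
  fixes f h S T :: "real \<Rightarrow> real" and I K :: "real set" and a b :: real
  assumes "open I" "is_interval I" "I \<noteq> {}"
    and "open K" "is_interval K" "K \<noteq> {}"
    and "C2_on f I" and "C2_on h K"
    and "regular_param (cpd_param f h) (I \<times> K)"
    and "canonical_principal_direction (cpd_param f h) (cpd_normal f h) (I \<times> K) (axis 3 1)"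
    and "\<And>p. p \<in> I \<times> K \<Longrightarrow> gauss_curvature (cpd_param f h) (cpd_normal f h) p \<noteq> 0"
    and "sec_power_antiderivative a S" and "sec_power_antiderivative (1 + a) T"
  shows "(\<forall>p \<in> I \<times> K.
            (cpd_normal f h p \<bullet> axis 1 1) * principal_radii_sum (cpd_param f h) (cpd_normal f h) p
              = a * (cpd_param f h p \<bullet> axis 1 1) + b)
     \<longleftrightarrow>
     (\<exists>C C1 C2 C3 C4 \<Theta> \<Phi>.
        nondegenerate a f I C1 C3 \<and>
        coordinate_change_on \<Theta> I \<and> coordinate_change_on \<Phi> K \<and>
        (\<forall>u\<in>I. \<forall>v\<in>K. (\<Theta> u, \<Phi> v) \<in> U_set a b S T C C1 C2 C3 C4) \<and>
        (\<forall>u\<in>I. (f u, u) = directrix a b S C C1 C2 (\<Theta> u)) \<and>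
        (\<forall>v\<in>K. (h v, v) = profile a T C C3 C4 (\<Phi> v)))"

proof -
  let ?X = "cpd_param f h" and ?N = "cpd_normal f h"
  note cf = assms(7,1) and ch = assms(8,4)
  have inj: "inj (frechet_derivative ?X (at (u, v)))" if "u \<in> I" "v \<in> K" for u v
    using assms(9) that by (auto simp: regular_param_def)
  have rates: "turning_rate f u \<noteq> 0" "turning_rate h v \<noteq> 0" if "u \<in> I" "v \<in> K" for u v
    using assms(11)[of "(u, v)"] that cpd_curvatures(2)[OF cf that(1) ch that(2) inj[OF that]]
    by auto
  then have nef: "\<And>u. u \<in> I \<Longrightarrow> turning_rate f u \<noteq> 0" and neh: "\<And>v. v \<in> K \<Longrightarrow> turning_rate h v \<noteq> 0"
    using assms(3,6) by blast+
  have cosf: "cos (tangent_angle f u) \<noteq> 0" for u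
    using cos_pos_half_open[OF tangent_angle_bounds] by (metis less_irrefl)
  have "(\<forall>p \<in> I \<times> K. (?N p \<bullet> axis 1 1) * principal_radii_sum ?X ?N p = a * (?X p \<bullet> axis 1 1) + b)
     \<longleftrightarrow> (\<forall>u\<in>I. \<forall>v\<in>K. 1 / turning_rate f u - a * f u - b
           = (1 / turning_rate h v - (1 + a) * h v) * cos (tangent_angle f u))"
    using cpd_equation_iff[OF cf _ ch _ inj nef neh] by (auto simp del: split_paired_All)
  also have "\<dots> \<longleftrightarrow> (\<exists>C. (\<forall>u\<in>I. 1 / turning_rate f u - a * f u - b = C * cos (tangent_angle f u)) \<and>
       (\<forall>v\<in>K. 1 / turning_rate h v - (1 + a) * h v = C))"
    by (rule separation_of_variables[OF cosf assms(3,6)])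
  also have "\<dots> \<longleftrightarrow> (\<exists>C. (\<forall>u\<in>I. 1 / turning_rate f u = a * f u + b + C * cos (tangent_angle f u)) \<and>
       (\<forall>v\<in>K. 1 / turning_rate h v = (1 + a) * h v + C))"
    by (simp add: diff_eq_eq algebra_simps)
  also have "\<dots> \<longleftrightarrow> (\<exists>C C1 C2 C3 C4 \<Theta> \<Phi>.
        nondegenerate a f I C1 C3 \<and>
        coordinate_change_on \<Theta> I \<and> coordinate_change_on \<Phi> K \<and>
        (\<forall>u\<in>I. \<forall>v\<in>K. (\<Theta> u, \<Phi> v) \<in> U_set a b S T C C1 C2 C3 C4) \<and>
        (\<forall>u\<in>I. (f u, u) = directrix a b S C C1 C2 (\<Theta> u)) \<and>
        (\<forall>v\<in>K. (h v, v) = profile a T C C3 C4 (\<Phi> v)))"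
    (is "(\<exists>C. ?ode C) \<longleftrightarrow> (\<exists>C C1 C2 C3 C4 \<Theta> \<Phi>. ?curves C C1 C2 C3 C4 \<Theta> \<Phi>)")
  proof
    assume "\<exists>C. ?ode C"
    then obtain C where
      odef: "\<And>u. u \<in> I \<Longrightarrow> 1 / turning_rate f u = a * f u + b + C * cos (tangent_angle f u)" and
      odeh: "\<And>v. v \<in> K \<Longrightarrow> 1 / turning_rate h v = (1 + a) * h v + C"
      by blast
    obtain C1 C2 where d: "\<And>u. u \<in> I \<Longrightarrow> (f u, u) = directrix a b S C C1 C2 (tangent_angle f u)"
      using directrix_solution[OF assms(12) cf assms(2) nef odef] by blast
    obtain C3 C4 where e: "\<And>v. v \<in> K \<Longrightarrow> (h v, v) = profile a T C C3 C4 (tangent_angle h v)"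
      using profile_solution[OF assms(13) ch assms(5) neh odeh] by blast
    obtain v where v: "v \<in> K" using assms(6) by blast
    have "nondegenerate a f I C1 C3"
      using nondegenerate_tangent_angle_curves[OF cf neh[OF v] odef odeh[OF v] d e[OF v]] .
    moreover have "(tangent_angle f u, tangent_angle h v) \<in> U_set a b S T C C1 C2 C3 C4"
      if uv: "u \<in> I" "v \<in> K" for u v
    proof -
      have x: "fst (directrix a b S C C1 C2 (tangent_angle f u)) = f u"
        and y: "fst (profile a T C C3 C4 (tangent_angle h v)) = h v"
        using d[OF uv(1)] e[OF uv(2)] by (metis fst_conv)+
      \<comment> \<open>The condition \<open>1 - \<kappa> h \<noteq> 0\<close> is the regularity of the patch, up to the factor \<open>cos \<theta>\<close>.\<close>
      have "1 + cos (tangent_angle f u) * turning_rate f u * h v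
          = cos (tangent_angle f u) * (1 / cos (tangent_angle f u) + h v * turning_rate f u)"
        using cosf by (simp add: field_simps)
      then have "1 + cos (tangent_angle f u) * turning_rate f u * h v \<noteq> 0"
        using cpd_curvatures(1)[OF cf uv(1) ch uv(2) inj[OF uv]] cosf by simp
      then show ?thesis
        unfolding U_set_iff[OF assms(12)] x y odef[OF uv(1), symmetric]
        using nef[OF uv(1)] tangent_angle_bounds by simp
    qed
    moreover have "coordinate_change_on (tangent_angle f) I" "coordinate_change_on (tangent_angle h) K"
      using coordinate_change_tangent_angle cf ch nef neh by blast+
    ultimately have "?curves C C1 C2 C3 C4 (tangent_angle f) (tangent_angle h)"
      using d e by blast
    then show "\<exists>C C1 C2 C3 C4 \<Theta> \<Phi>. ?curves C C1 C2 C3 C4 \<Theta> \<Phi>" by blast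
  next
    assume "\<exists>C C1 C2 C3 C4 \<Theta> \<Phi>. ?curves C C1 C2 C3 C4 \<Theta> \<Phi>"
    then obtain C C1 C2 C3 C4 \<Theta> \<Phi> where c: "?curves C C1 C2 C3 C4 \<Theta> \<Phi>" by blast
    then have range: "\<And>u. u \<in> I \<Longrightarrow> \<Theta> u \<in> {-pi/2<..<pi/2}" "\<And>v. v \<in> K \<Longrightarrow> \<Phi> v \<in> {-pi/2<..<pi/2}"
      using assms(3,6) unfolding U_set_iff[OF assms(12)] by blast+
    have d: "\<And>u. u \<in> I \<Longrightarrow> (f u, u) = directrix a b S C C1 C2 (\<Theta> u)"
      and e: "\<And>v. v \<in> K \<Longrightarrow> (h v, v) = profile a T C C3 C4 (\<Phi> v)"
      and cc: "coordinate_change_on \<Theta> I" "coordinate_change_on \<Phi> K" using c by blast+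
    have "1 / turning_rate f u = a * f u + b + C * cos (tangent_angle f u)" if u: "u \<in> I" for u
      using tangent_angle_of_parametrization[OF assms(1) cc(1) range(1) directrix_derivs[OF assms(12)] d u]
        d[OF u] by (metis fst_conv)
    moreover have "1 / turning_rate h v = (1 + a) * h v + C" if v: "v \<in> K" for v
      using tangent_angle_of_parametrization(2)[OF assms(4) cc(2) range(2) profile_derivs[OF assms(13)] e v]
        e[OF v] by (metis fst_conv)
    ultimately show "\<exists>C. ?ode C" by blast
  qed
  finally show ?thesis .
qed

end
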